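(* Let $M,K,N\ge 1$ be integers (antennas, users, sub-carriers), let $b$ be a positive integer or $\infty$, $\sigma^2>0$, and let $\zeta_b$, the channels $h_{k,n}\in\mathbb{C}^M$, the downlink SQINR $\gamma^{\mathrm{DL}}_{k,n}(\bar T,\bar Q_{\mathrm{PA}},q)$, the uplink SQINR $\gamma^{\mathrm{UL}}_{k,n}(\bar u_{k,n},p)$, the uplink Bussgang gain $\bar A_{\mathrm u}=\bar A_{\mathrm u}(p)$ and the matrices $\bar D(\bar T),\bar\Psi(\bar T),\bar\Phi(\bar T)$ be as defined in the context. Let $\gamma_{k,n}>0$ ($1\le k\le K$, $1\le n\le N$) be target SQINR values, and suppose that the beamforming matrix $\bar T$ with unit-norm beamformers $t_{k,n}$, the downlink power allocation vector $q\ge 0$, $q\in\mathbb{R}^{KN}$, and the per-antenna power allocation matrix $$\bar Q_{\mathrm{PA}}=I_N\otimes \mathrm{diag}\Big(\tfrac1N\sum_{n=1}^N T_nQ_nQ_n^{H}T_n^{H}\Big)^{1/2}$$ achieve these targets in the downlink, i.e. $\gamma^{\mathrm{DL}}_{k,n}(\bar T,\bar Q_{\mathrm{PA}},q)=\gamma_{k,n}$ for all $k,n$ (where $\mathrm{diag}(\sum_n T_nQ_nQ_n^HT_n^H)$ is invertible, so that the downlink Bussgang gain is defined). Then the same SQINR values are achieved in the uplink with the same sum power. Precisely, the vector $$p=\frac{\sigma^2}{\zeta_b^2}\Big(I_{KN}-\bar D(\bar T)\bar\Psi^{T}(\bar T)-\bar D(\bar T)\bar\Phi^{T}(\bar T)\Big)^{-1}\bar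 D(\bar T)\,\mathbf 1_{KN}$$ is a well-defined power allocation vector (the inverse exists and $p$ has nonnegative entries), and, whenever the uplink combiners $\bar u_{k,n}$ are related to the downlink beamformers by $\bar t_{k,n}=\bar A_{\mathrm u}(p)\bar u_{k,n}/\|\bar A_{\mathrm u}(p)\bar u_{k,n}\|_2$, one has $\gamma^{\mathrm{UL}}_{k,n}(\bar u_{k,n},p)=\gamma_{k,n}$ for all $1\le k\le K$, $1\le n\le N$, and $\|p\|_1=\|q\|_1$.
   Context: Conventions. $(\cdot)^T,(\cdot)^H,(\cdot)^*$ denote transpose, conjugate transpose, entrywise conjugate. For a square matrix $B$, $\mathrm{diag}(B)$ is the diagonal matrix with the same diagonal as $B$; for a vector $v$, $\mathrm{diag}(v)$ is the diagonal matrix with diagonal $v$. $F_N$ is the unitary $N\times N$ DFT matrix. $\mathbf 1_{KN}$ is the all-ones vector. The pair (user $k$, sub-carrier $n$) is identified with the index $(n-1)K+k\in\{1,\dots,KN\}$; thus $q=(q_{k,n})$, $p=(p_{k,n})$ are vectors in $\mathbb{R}^{KN}$. Quantizer constant (the scalar of the Bussgang decomposition of a $b$-bit constant envelope quantizer): $\zeta_b=\frac{2^b}{2\sqrt\pi}\sin(\pi/2^b)$ for finite $b$, and $\zeta_\infty=\sqrt{\pi/4}$. Channels and beamformers. $h_{k,n}\in\mathbb{C}^M$ is the frequency-domain channel of user $k$ on sub-carrier $n$, $H_n=[h_{1,n},\dots,h_{K,n}]$, $R_{k,n}=h_{k,n}h_{k,n}^H$. $t_{k,n}\in\mathbb{C}^M$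 with $\|t_{k,n}\|_2=1$, $T_n=[t_{1,n},\dots,t_{K,n}]$, $\bar T=\mathrm{blkDiag}(T_1,\dots,T_N)$. $u_{k,n}\in\mathbb{C}^M$ are nonzero uplink combiners. For a vector $x_{k,n}\in\mathbb{C}^M$ ($x=h,t,u$), $\bar x_{k,n}\in\mathbb{C}^{MN}$ denotes the vector whose $n$-th length-$M$ block is $x_{k,n}$ and whose other blocks are zero. $\bar R_{k,n}=\bar h_{k,n}\bar h_{k,n}^H$. $Q_n=\mathrm{diag}(\sqrt{q_{1,n}},\dots,\sqrt{q_{K,n}})$, $P_n=\mathrm{diag}(\sqrt{p_{1,n}},\dots,\sqrt{p_{K,n}})$. Bussgang gains: $$\bar A_{\mathrm d}=I_N\otimes \zeta_b\,\mathrm{diag}\Big(\tfrac1N\sum_{n=1}^N T_nQ_nQ_n^HT_n^H\Big)^{-1/2},\qquad \bar A_{\mathrm u}(p)=I_N\otimes \zeta_b\,\mathrm{diag}\Big(\tfrac1N\sum_{n=1}^N\big(H_nP_nP_n^HH_n^H+\sigma^2I_M\big)\Big)^{-1/2}.$$ Standing assumption (uncorrelated quantization noise, "small angle approximation"): the covariance matrices of the downlink and uplink quantization noise are taken to be $R_{\bar\eta_{\mathrm d}}=R_{\bar\eta_{\mathrm u}}=(1-\zeta_b^2)I_{MN}$. Signal-to-quantization-plus-interference-plus-noise ratios (SQINR), with $W=F_N\otimes I_M$: $$\gamma^{\mathrm{DL}}_{k,n}(\bar T,\bar Q_{\mathrm{PA}},q)=\frac{q_{k,n}\,\bar t_{k,n}^T\bar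 A_{\mathrm d}\bar Q_{\mathrm{PA}}\bar R_{k,n}\bar Q_{\mathrm{PA}}^H\bar A_{\mathrm d}^H\bar t_{k,n}^*}{\sum_{i\ne k}q_{i,n}\,\bar t_{i,n}^T\bar A_{\mathrm d}\bar Q_{\mathrm{PA}}\bar R_{k,n}\bar Q_{\mathrm{PA}}^H\bar A_{\mathrm d}^H\bar t_{i,n}^*+\sigma^2+\mathrm{tr}\big(W\bar Q_{\mathrm{PA}}R_{\bar\eta_{\mathrm d}}\bar Q_{\mathrm{PA}}^HW^H\bar R_{k,n}^*\big)},$$ $$\gamma^{\mathrm{UL}}_{k,n}(\bar u_{k,n},p)=\frac{p_{k,n}\,\bar u_{k,n}^T\bar A_{\mathrm u}\bar R_{k,n}\bar A_{\mathrm u}^H\bar u_{k,n}^*}{\bar u_{k,n}^T\Big(\sum_{i\neq k}p_{i,n}\bar A_{\mathrm u}\bar R_{i,n}\bar A_{\mathrm u}^H+\sigma^2\bar A_{\mathrm u}\bar A_{\mathrm u}^H+WR_{\bar\eta_{\mathrm u}}W^H\Big)\bar u_{k,n}^*},\qquad \bar A_{\mathrm u}=\bar A_{\mathrm u}(p).$$ Matrices ($KN\times KN$): $\bar D(\bar T)$ is diagonal with $((k,n),(k,n))$ entry $\gamma_{k,n}/(t_{k,n}^TR_{k,n}t_{k,n}^* )$. $\bar\Psi(\bar T)$ (multi-user interference coupling) has $((k,n),(i,j))$ entry $t_{i,n}^TR_{k,n}t_{i,n}^*$ if $j=n$ and $i\ne k$, and $0$ otherwise. $\bar\Phi(\bar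 T)$ (quantization coupling) has $((k,n),(i,j))$ entry $t_{i,j}^T\tilde R_{k,n}t_{i,j}^*$, where $\tilde R_{k,n}=\frac1N\big(\frac1{\zeta_b^2}-1\big)\mathrm{diag}(R_{k,n})$. *)

theory Defs
  imports "HOL-Analysis.Analysis" "HOL-Library.Extended_Nat"
begin

text \<open>
  Index types: \<open>'m\<close> antennas, \<open>'k\<close> users, \<open>'n\<close> sub-carriers. A vector of length \<open>M N\<close> made of
  \<open>N\<close> blocks of length \<open>M\<close> is indexed by \<open>'n \<times> 'm\<close>; a vector of length \<open>K N\<close> is indexed by
  \<open>'k \<times> 'n\<close>, the pair \<open>(k, n)\<close> standing for the position \<open>(n - 1) K + k\<close>. The linear order on
  \<open>'n\<close> numbers the sub-carriers and is used only for the DFT matrix.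
\<close>

section \<open>Matrix notation\<close>

definition conj_vec :: "complex^'i \<Rightarrow> complex^'i" where
  "conj_vec x = (\<chi> i. cnj (x $ i))"

definition herm :: "complex^'j^'i \<Rightarrow> complex^'i^'j" where
  "herm A = map_matrix cnj (transpose A)"

text \<open>The form \<open>x\<^sup>T B x\<^sup>*\<close>.\<close>

definition qform :: "complex^'i \<Rightarrow> complex^'i^'i \<Rightarrow> complex" where
  "qform x B = scalar_product x (B *v conj_vec x)"

definition outer :: "complex^'i \<Rightarrow> complex^'i^'i" where
  "outer h = (\<chi> i j. h $ i * cnj (h $ j))"

definition diag_vec :: "complex^'i \<Rightarrow> complex^'i^'i" where
  "diag_vec v = (\<chi> i j. if i = j then v $ i else 0)"

definition diag_part :: "complex^'i^'i \<Rightarrow> complex^'i^'i" where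
  "diag_part B = diag_vec (\<chi> i. B $ i $ i)"

text \<open>Square root of a diagonal matrix; it is only applied to nonnegative diagonals.\<close>

definition diag_sqrt :: "complex^'i^'i \<Rightarrow> complex^'i^'i" where
  "diag_sqrt B = diag_vec (\<chi> i. csqrt (B $ i $ i))"

definition kron :: "complex^'n^'n \<Rightarrow> complex^'m^'m
    \<Rightarrow> complex^('n::finite \<times> 'm::finite)^('n \<times> 'm)" where
  "kron A B = (\<chi> i j. A $ fst i $ fst j * B $ snd i $ snd j)"

definition dft :: "complex^('n::{finite,linorder})^('n::{finite,linorder})" where
  "dft = (\<chi> i j. cis (- 2 * pi * real (card {l. l < i}) * real (card {l. l < j}) / real CARD('n))
                 / complex_of_real (sqrt (real CARD('n))))"

definition block_embed :: "'n::finite \<Rightarrow> complex^'m \<Rightarrow> complex^('n \<times> 'm)" where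
  "block_embed n x = (\<chi> i. if fst i = n then x $ snd i else 0)"

definition norm1 :: "real^'i \<Rightarrow> real" where
  "norm1 v = (\<Sum>i\<in>UNIV. \<bar>v $ i\<bar>)"

section \<open>System model\<close>

definition zeta :: "enat \<Rightarrow> real" where
  "zeta b = (case b of enat r \<Rightarrow> 2 ^ r / (2 * sqrt pi) * sin (pi / 2 ^ r) | \<infinity> \<Rightarrow> sqrt (pi / 4))"

text \<open>The matrix with columns \<open>x\<^sub>1\<^sub>,\<^sub>n, \<dots>, x\<^sub>K\<^sub>,\<^sub>n\<close>; it gives \<open>H\<^sub>n\<close> and \<open>T\<^sub>n\<close>.\<close>

definition cols :: "('k \<Rightarrow> 'n \<Rightarrow> complex^'m) \<Rightarrow> 'n \<Rightarrow> complex^'k^'m" where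
  "cols x n = (\<chi> m k. x k n $ m)"

text \<open>\<open>Q\<^sub>n\<close> and \<open>P\<^sub>n\<close>.\<close>

definition sqrt_power :: "real^('k::finite \<times> 'n::finite) \<Rightarrow> 'n \<Rightarrow> complex^'k^'k" where
  "sqrt_power q n = diag_vec (\<chi> k. complex_of_real (sqrt (q $ (k, n))))"

definition tx_cov :: "('k::finite \<Rightarrow> 'n::finite \<Rightarrow> complex^'m) \<Rightarrow> real^('k \<times> 'n) \<Rightarrow> complex^'m^'m" where
  "tx_cov t q = (\<Sum>n\<in>UNIV. cols t n ** sqrt_power q n ** herm (sqrt_power q n) ** herm (cols t n))"

definition rx_cov ::
  "real \<Rightarrow> ('k::finite \<Rightarrow> 'n::finite \<Rightarrow> complex^'m) \<Rightarrow> real^('k \<times> 'n) \<Rightarrow> complex^'m^'m" where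
  "rx_cov \<sigma> h p =
     (\<Sum>n\<in>UNIV. cols h n ** sqrt_power p n ** herm (sqrt_power p n) ** herm (cols h n)
                + \<sigma>\<^sup>2 *\<^sub>R mat 1)"

definition Q_PA ::
  "('k::finite \<Rightarrow> 'n::finite \<Rightarrow> complex^'m) \<Rightarrow> real^('k \<times> 'n) \<Rightarrow> complex^('n \<times> 'm)^('n \<times> 'm)" where
  "Q_PA t q = kron (mat 1) (diag_sqrt (diag_part ((1 / real CARD('n)) *\<^sub>R tx_cov t q)))"

definition A_d ::
  "enat \<Rightarrow> ('k::finite \<Rightarrow> 'n::finite \<Rightarrow> complex^'m) \<Rightarrow> real^('k \<times> 'n)
    \<Rightarrow> complex^('n \<times> 'm)^('n \<times> 'm)" where
  "A_d b t q = kron (mat 1)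
     (zeta b *\<^sub>R matrix_inv (diag_sqrt (diag_part ((1 / real CARD('n)) *\<^sub>R tx_cov t q))))"

definition A_u ::
  "enat \<Rightarrow> real \<Rightarrow> ('k::finite \<Rightarrow> 'n::finite \<Rightarrow> complex^'m) \<Rightarrow> real^('k \<times> 'n)
    \<Rightarrow> complex^('n \<times> 'm)^('n \<times> 'm)" where
  "A_u b \<sigma> h p = kron (mat 1)
     (zeta b *\<^sub>R matrix_inv (diag_sqrt (diag_part ((1 / real CARD('n)) *\<^sub>R rx_cov \<sigma> h p))))"

text \<open>Covariance of the downlink and of the uplink quantization noise, taken to be uncorrelated
  (small angle approximation).\<close>

definition R_eta :: "enat \<Rightarrow> complex^('n::finite \<times> 'm::finite)^('n \<times> 'm)" where
  "R_eta b = mat (complex_of_real (1 - (zeta b)\<^sup>2))"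

definition W_dft :: "complex^('n::{finite,linorder} \<times> 'm::finite)^('n \<times> 'm)" where
  "W_dft = kron dft (mat 1)"

text \<open>The ratios are built from complex quadratic forms and therefore complex-valued as terms. The
  block matrix of the beamformers enters through its columns \<open>block_embed n (t k n)\<close>.\<close>

definition gamma_DL ::
  "enat \<Rightarrow> real \<Rightarrow> ('k::finite \<Rightarrow> 'n::{finite,linorder} \<Rightarrow> complex^'m)
    \<Rightarrow> ('k \<Rightarrow> 'n \<Rightarrow> complex^'m) \<Rightarrow> complex^('n \<times> 'm)^('n \<times> 'm) \<Rightarrow> real^('k \<times> 'n)
    \<Rightarrow> 'k \<Rightarrow> 'n \<Rightarrow> complex" where
  "gamma_DL b \<sigma> h t Q q k n =
    (let A = A_d b t q;
         R = outer (block_embed n (h k n));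
         G = A ** Q ** R ** herm Q ** herm A
     in complex_of_real (q $ (k, n)) * qform (block_embed n (t k n)) G
        / ((\<Sum>i\<in>UNIV - {k}. complex_of_real (q $ (i, n)) * qform (block_embed n (t i n)) G)
           + complex_of_real (\<sigma>\<^sup>2)
           + trace (W_dft ** Q ** R_eta b ** herm Q ** herm W_dft ** map_matrix cnj R)))"

definition gamma_UL ::
  "enat \<Rightarrow> real \<Rightarrow> ('k::finite \<Rightarrow> 'n::{finite,linorder} \<Rightarrow> complex^'m)
    \<Rightarrow> complex^('n \<times> 'm) \<Rightarrow> real^('k \<times> 'n) \<Rightarrow> 'k \<Rightarrow> 'n \<Rightarrow> complex" where
  "gamma_UL b \<sigma> h u p k n =
    (let A = A_u b \<sigma> h p;
         R = (\<lambda>i. outer (block_embed n (h i n)))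
     in complex_of_real (p $ (k, n)) * qform u (A ** R k ** herm A)
        / qform u ((\<Sum>i\<in>UNIV - {k}. p $ (i, n) *\<^sub>R (A ** R i ** herm A))
                   + \<sigma>\<^sup>2 *\<^sub>R (A ** herm A)
                   + W_dft ** R_eta b ** herm W_dft))"

section \<open>Coupling matrices\<close>

text \<open>The forms below are real because the matrices are Hermitian, so \<open>Re\<close> only changes the type.\<close>

lemma qform_real:
  assumes "herm B = B"
  shows "complex_of_real (Re (qform x B)) = qform x B"
proof -
  have B: "cnj (B $ j $ i) = B $ i $ j" for i j
    using assms by (metis (no_types, lifting) herm_def map_matrix_def transpose_def
        vec_lambda_beta)
  have "cnj (qform x B) = (\<Sum>i\<in>UNIV. \<Sum>j\<in>UNIV. cnj (x $ i) * (B $ j $ i * x $ j))"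
    by (simp add: qform_def scalar_product_def conj_vec_def matrix_vector_mult_def sum_distrib_left B)
  also have "\<dots> = (\<Sum>j\<in>UNIV. \<Sum>i\<in>UNIV. cnj (x $ i) * (B $ j $ i * x $ j))"
    by (rule sum.swap)
  also have "\<dots> = qform x B"
    by (simp add: qform_def scalar_product_def conj_vec_def matrix_vector_mult_def sum_distrib_left
        algebra_simps)
  finally show ?thesis
    by (simp add: complex_eq_iff)
qed

definition D_mat ::
  "('k::finite \<Rightarrow> 'n::finite \<Rightarrow> real) \<Rightarrow> ('k \<Rightarrow> 'n \<Rightarrow> complex^'m) \<Rightarrow> ('k \<Rightarrow> 'n \<Rightarrow> complex^'m)
    \<Rightarrow> real^('k \<times> 'n)^('k \<times> 'n)" where
  "D_mat \<gamma> h t = (\<chi> x y. case x of (k, n) \<Rightarrow>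
     if x = y then \<gamma> k n / Re (qform (t k n) (outer (h k n))) else 0)"

definition Psi_mat ::
  "('k::finite \<Rightarrow> 'n::finite \<Rightarrow> complex^'m) \<Rightarrow> ('k \<Rightarrow> 'n \<Rightarrow> complex^'m)
    \<Rightarrow> real^('k \<times> 'n)^('k \<times> 'n)" where
  "Psi_mat h t = (\<chi> x y. case x of (k, n) \<Rightarrow> case y of (i, j) \<Rightarrow>
     if j = n \<and> i \<noteq> k then Re (qform (t i n) (outer (h k n))) else 0)"

definition R_tilde :: "enat \<Rightarrow> ('k \<Rightarrow> 'n::finite \<Rightarrow> complex^'m) \<Rightarrow> 'k \<Rightarrow> 'n \<Rightarrow> complex^'m^'m" where
  "R_tilde b h k n =
     (1 / real CARD('n) * (1 / (zeta b)\<^sup>2 - 1)) *\<^sub>R diag_part (outer (h k n))"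

definition Phi_mat ::
  "enat \<Rightarrow> ('k::finite \<Rightarrow> 'n::finite \<Rightarrow> complex^'m) \<Rightarrow> ('k \<Rightarrow> 'n \<Rightarrow> complex^'m)
    \<Rightarrow> real^('k \<times> 'n)^('k \<times> 'n)" where
  "Phi_mat b h t = (\<chi> x y. case x of (k, n) \<Rightarrow> case y of (i, j) \<Rightarrow>
     Re (qform (t i j) (R_tilde b h k n)))"

definition coupling ::
  "enat \<Rightarrow> ('k::finite \<Rightarrow> 'n::finite \<Rightarrow> real) \<Rightarrow> ('k \<Rightarrow> 'n \<Rightarrow> complex^'m)
    \<Rightarrow> ('k \<Rightarrow> 'n \<Rightarrow> complex^'m) \<Rightarrow> real^('k \<times> 'n)^('k \<times> 'n)" where
  "coupling b \<gamma> h t =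
     mat 1 - D_mat \<gamma> h t ** transpose (Psi_mat h t) - D_mat \<gamma> h t ** transpose (Phi_mat b h t)"

definition ul_power ::
  "enat \<Rightarrow> real \<Rightarrow> ('k::finite \<Rightarrow> 'n::finite \<Rightarrow> real) \<Rightarrow> ('k \<Rightarrow> 'n \<Rightarrow> complex^'m)
    \<Rightarrow> ('k \<Rightarrow> 'n \<Rightarrow> complex^'m) \<Rightarrow> real^('k \<times> 'n)" where
  "ul_power b \<sigma> \<gamma> h t =
     (\<sigma>\<^sup>2 / (zeta b)\<^sup>2) *\<^sub>R (matrix_inv (coupling b \<gamma> h t) *v (D_mat \<gamma> h t *v 1))"

end

theory Submission
  imports Defs
begin

text \<open>
  Write \<open>E = \<Psi> + \<Phi>\<close> and \<open>c = \<sigma>\<^sup>2 / \<zeta>\<^sub>b\<^sup>2\<close>. The power allocation matrix cancels the downlink Bussgang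
  gain, so the downlink targets amount to the linear system \<open>(D\<^sup>-\<^sup>1 - E) q = c 1\<close>. As \<open>c > 0\<close>, this
  forces \<open>q > 0\<close> and says that \<open>D\<^sup>-\<^sup>1 - E\<^sup>T\<close>, whose off-diagonal entries are nonpositive, is column
  diagonally dominant with weights \<open>q\<close>; hence it is invertible with nonnegative inverse, and \<open>p\<close> is
  the solution of \<open>(D\<^sup>-\<^sup>1 - E\<^sup>T) p = c 1\<close>. The noise terms of the uplink ratio add up to \<open>E\<^sup>T p + c 1\<close>
  because the beamformers have unit norm, which gives the uplink targets. Finally
  \<open>c 1\<^sup>T p = q\<^sup>T (D\<^sup>-\<^sup>1 - E\<^sup>T) p = c q\<^sup>T 1\<close>.
\<close>

section \<open>Weighted diagonal dominance\<close>

text \<open>Adding up the inequalities with the weights \<open>q\<close>, the balance equations cancel everything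
  except \<open>\<Sum>y. c y * x y \<le> 0\<close>.\<close>

lemma dominance_zero:
  fixes E :: "'a::finite \<Rightarrow> 'a \<Rightarrow> real"
  assumes q: "\<And>y. q y > 0" and c: "\<And>y. c y > 0"
    and balance: "\<And>z. d z * q z = (\<Sum>y\<in>UNIV. E z y * q y) + c z"
    and x: "\<And>y. x y \<ge> 0" "\<And>y. d y * x y \<le> (\<Sum>z\<in>UNIV. E z y * x z)"
  shows "x y = 0"
proof -
  have "(\<Sum>y\<in>UNIV. q y * (d y * x y)) \<le> (\<Sum>y\<in>UNIV. q y * (\<Sum>z\<in>UNIV. E z y * x z))"
    using q x(2) by (intro sum_mono mult_left_mono) (auto simp: less_imp_le)
  also have "\<dots> = (\<Sum>z\<in>UNIV. x z * (\<Sum>y\<in>UNIV. E z y * q y))"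
    unfolding sum_distrib_left by (subst sum.swap) (simp add: mult_ac)
  also have "\<dots> = (\<Sum>z\<in>UNIV. q z * (d z * x z)) - (\<Sum>z\<in>UNIV. c z * x z)"
    unfolding sum_subtractf [symmetric]
  proof (intro sum.cong refl)
    fix z
    have "(\<Sum>y\<in>UNIV. E z y * q y) = d z * q z - c z" using balance by simp
    then show "x z * (\<Sum>y\<in>UNIV. E z y * q y) = q z * (d z * x z) - c z * x z"
      by (simp only: right_diff_distrib mult_ac)
  qed
  finally have "(\<Sum>z\<in>UNIV. c z * x z) \<le> 0" by simp
  moreover have nn: "0 \<le> c z * x z" for z using c x(1) by (simp add: less_imp_le)
  ultimately have "(\<Sum>z\<in>UNIV. c z * x z) = 0"
    by (simp add: sum_nonneg antisym)
  with nn have "c y * x y = 0" by (simp add: sum_nonneg_eq_0_iff)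
  with c [of y] show ?thesis by simp
qed

text \<open>The triangle inequality turns the equations for \<open>x\<close> into inequalities for
  the absolute values, to which \<open>dominance_zero\<close> applies. The signs of \<open>d\<close>
  and \<open>E\<close> let both move through the absolute value.\<close>

lemma dominance_kernel:
  fixes E :: "'a::finite \<Rightarrow> 'a \<Rightarrow> real"
  assumes q: "\<And>y. q y > 0" and c: "\<And>y. c y > 0"
    and balance: "\<And>z. d z * q z = (\<Sum>y\<in>UNIV. E z y * q y) + c z"
    and E: "\<And>z y. E z y \<ge> 0" and d: "\<And>y. d y \<ge> 0"
    and x: "\<And>y. d y * x y = (\<Sum>z\<in>UNIV. E z y * x z)"
  shows "x y = 0"
proof -
  have "d y * \<bar>x y\<bar> \<le> (\<Sum>z\<in>UNIV. E z y * \<bar>x z\<bar>)" for y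
  proof -
    have "d y * \<bar>x y\<bar> = \<bar>\<Sum>z\<in>UNIV. E z y * x z\<bar>"
      using d [of y] by (simp add: abs_mult flip: x)
    also have "\<dots> \<le> (\<Sum>z\<in>UNIV. \<bar>E z y * x z\<bar>)" by (rule sum_abs)
    finally show ?thesis using E by (simp add: abs_mult)
  qed
  then have "\<bar>x y\<bar> = 0"
    by (intro dominance_zero [of q c d E "\<lambda>y. \<bar>x y\<bar>", OF q c balance]) simp_all
  then show ?thesis by simp
qed

text \<open>Apply \<open>dominance_zero\<close> to the negative part of \<open>x\<close>. Where
  \<open>x\<close> is negative, dropping \<open>e\<close> and replacing each \<open>- x z\<close> by
  its positive part only enlarges the right-hand side; elsewhere the left-hand side is 0.\<close>

lemma dominance_nonneg:
  fixes E :: "'a::finite \<Rightarrow> 'a \<Rightarrow> real"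
  assumes q: "\<And>y. q y > 0" and c: "\<And>y. c y > 0"
    and balance: "\<And>z. d z * q z = (\<Sum>y\<in>UNIV. E z y * q y) + c z"
    and E: "\<And>z y. E z y \<ge> 0" and e: "\<And>y. e y \<ge> 0"
    and x: "\<And>y. d y * x y = (\<Sum>z\<in>UNIV. E z y * x z) + e y"
  shows "x y \<ge> 0"
proof -
  have "d y * max 0 (- x y) \<le> (\<Sum>z\<in>UNIV. E z y * max 0 (- x z))" for y
  proof (cases "x y < 0")
    case True
    have "- (\<Sum>z\<in>UNIV. E z y * x z) \<le> (\<Sum>z\<in>UNIV. E z y * max 0 (- x z))"
      unfolding sum_negf [symmetric] mult_minus_right [symmetric]
      by (intro sum_mono mult_left_mono E) simp
    with True x [of y] e [of y] show ?thesis by simp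
  qed (simp add: sum_nonneg E)
  then have "max 0 (- x y) = 0"
    by (intro dominance_zero [of q c d E "\<lambda>y. max 0 (- x y)", OF q c balance]) simp_all
  then show ?thesis by simp
qed

section \<open>Matrices and quadratic forms\<close>

lemma herm_nth [simp]: "herm A $ i $ j = cnj (A $ j $ i)"
  by (simp add: herm_def map_matrix_def transpose_def)

lemma diag_vec_nth [simp]: "diag_vec v $ i $ j = (if i = j then v $ i else 0)"
  by (simp add: diag_vec_def)

lemma kron_nth [simp]: "kron A B $ i $ j = A $ fst i $ fst j * B $ snd i $ snd j"
  by (simp add: kron_def)

lemma block_embed_nth [simp]: "block_embed n x $ i = (if fst i = n then x $ snd i else 0)"
  by (simp add: block_embed_def)

lemma outer_nth [simp]: "outer h $ i $ j = h $ i * cnj (h $ j)"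
  by (simp add: outer_def)

lemma mat_eq_diag_vec: "mat c = diag_vec (\<chi> i. c)"
  by (simp add: vec_eq_iff mat_def)

lemma diag_vec_mult: "diag_vec a ** diag_vec b = diag_vec (\<chi> i. a $ i * b $ i)"
  by (simp add: vec_eq_iff matrix_matrix_mult_def if_distrib [of "\<lambda>x. x * _"] cong: if_cong)

lemma diag_vec_vector_mult: "diag_vec a *v x = (\<chi> i. a $ i * x $ i)"
  by (simp add: vec_eq_iff matrix_vector_mult_def if_distrib [of "\<lambda>x. x * _"] cong: if_cong)

lemma herm_diag_vec: "herm (diag_vec a) = diag_vec (conj_vec a)"
  by (simp add: vec_eq_iff conj_vec_def)

lemma transpose_diag_vec: "transpose (diag_vec a) = diag_vec a"
  by (simp add: vec_eq_iff transpose_def)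

lemma kron_mat_diag_vec: "kron (mat 1) (diag_vec a) = diag_vec (\<chi> i. a $ snd i)"
  by (auto simp: vec_eq_iff mat_def prod_eq_iff)

text \<open>\<open>matrix_inv\<close> is a Hilbert choice; a two-sided inverse is unique, so
  exhibiting one determines the chosen value.\<close>

lemma matrix_inv_eqI:
  fixes A :: "'a::semiring_1^'n^'n"
  assumes "A ** B = mat 1" "B ** A = mat 1"
  shows "matrix_inv A = B"
proof -
  have "A ** matrix_inv A = mat 1 \<and> matrix_inv A ** A = mat 1"
    unfolding matrix_inv_def by (rule someI [of _ B]) (use assms in simp)
  then show ?thesis
    by (metis assms(2) matrix_mul_assoc matrix_mul_lid matrix_mul_rid)
qed

lemma matrix_inv_diag_vec:
  assumes "\<And>i. a $ i \<noteq> 0"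
  shows "matrix_inv (diag_vec a) = diag_vec (\<chi> i. inverse (a $ i))"
  using assms by (intro matrix_inv_eqI) (simp_all add: diag_vec_mult mat_eq_diag_vec)

lemma invertible_diag_vec_nonzero:
  assumes "invertible (diag_vec a)"
  shows "a $ i \<noteq> 0"
proof -
  obtain B where "diag_vec a ** B = mat 1"
    using assms by (auto simp: invertible_def)
  then have "(diag_vec a ** B) $ i $ i = 1"
    by (simp add: mat_def)
  then show ?thesis
    by (auto simp: matrix_matrix_mult_def if_distrib [of "\<lambda>x. x * _"] cong: if_cong)
qed

section \<open>Kronecker products and unitarity of the DFT matrix\<close>

lemma kron_mult: "kron A B ** kron C D = kron (A ** C) (B ** D)"
proof -
  have "(kron A B ** kron C D) $ i $ j
      = (\<Sum>k\<in>UNIV. \<Sum>l\<in>UNIV. A $ fst i $ k * C $ k $ fst j * (B $ snd i $ l * D $ l $ snd j))" for i j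
    unfolding matrix_matrix_mult_def UNIV_Times_UNIV [symmetric] sum.cartesian_product
    by (auto intro!: sum.cong)
  then show ?thesis
    unfolding vec_eq_iff kron_nth by (simp add: matrix_matrix_mult_def sum_product)
qed

lemma herm_kron: "herm (kron A B) = kron (herm A) (herm B)"
  by (simp add: vec_eq_iff)

lemma herm_mat: "herm (mat c) = mat (cnj c)"
  by (simp add: vec_eq_iff mat_def)

lemma kron_mat: "kron (mat 1) (mat c) = mat c"
  by (auto simp: vec_eq_iff mat_def prod_eq_iff)

text \<open>The number of smaller elements is the zero-based rank used in the exponents of
  \<open>dft\<close>. It is strictly increasing, hence injective, and a cardinality count makes it
  onto.\<close>

lemma card_less_bij:
  "bij_betw (\<lambda>i::'n::{finite,linorder}. card {l. l < i}) UNIV {..<CARD('n)}"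
proof -
  have less: "card {l. l < i} < card {l. l < j}" if "i < j" for i j :: 'n
  proof (rule psubset_card_mono)
    show "{l. l < i} \<subset> {l. l < j}"
    proof
      show "{l. l < i} \<subseteq> {l. l < j}" using that by (blast intro: less_trans)
      show "{l. l < i} \<noteq> {l. l < j}" using that less_irrefl [of i] by blast
    qed
  qed simp
  have inj: "inj (\<lambda>i::'n. card {l. l < i})"
  proof (rule injI)
    fix i j :: 'n
    assume "card {l. l < i} = card {l. l < j}"
    then show "i = j" using less [of i j] less [of j i] by (cases i j rule: linorder_cases) simp_all
  qed
  moreover have "range (\<lambda>i::'n. card {l. l < i}) \<subseteq> {..<CARD('n)}"
  proof clarsimp
    fix i :: 'n
    have "{l. l < i} \<subset> UNIV" using less_irrefl [of i] by blast
    then show "card {l. l < i} < CARD('n)" by (intro psubset_card_mono) simp_all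
  qed
  moreover have "card (range (\<lambda>i::'n. card {l. l < i})) = card {..<CARD('n)}"
    by (simp add: card_image [OF inj])
  ultimately show ?thesis
    by (simp add: bij_betw_def card_subset_eq)
qed

text \<open>For distinct \<open>a\<close> and \<open>b\<close> this is a geometric sum whose ratio
  \<open>w\<close> is an \<open>N\<close>-th root of unity other than 1.\<close>

lemma sum_cis_roots_of_unity:
  fixes a b N :: nat
  assumes "a < N" "b < N"
  shows "(\<Sum>l<N. cis (2 * pi * (real b - real a) * real l / real N))
      = (if a = b then of_nat N else 0)"
proof (cases "a = b")
  case False
  define w where "w = cis (2 * pi * (real b - real a) / real N)"
  have N: "N > 0" using assms by simp
  \<comment> \<open>Otherwise the angle is a multiple of 2 pi, so \<open>N\<close> divides
    \<open>b - a\<close>; this contradicts 0 < |b - a| < N.\<close>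
  have "w \<noteq> 1"
  proof
    assume "w = 1"
    then have "cos (2 * pi * (real b - real a) / real N) = 1"
      unfolding w_def by (simp add: complex_eq_iff)
    then obtain m :: int where "2 * pi * (real b - real a) / real N = m * 2 * pi"
      by (auto simp: cos_one_2pi_int)
    then have "(2 * pi) * (real b - real a) = (2 * pi) * (m * real N)"
      using N by (simp add: divide_eq_eq mult_ac)
    then have "real b - real a = m * real N"
      by (subst (asm) mult_cancel_left) simp
    then have "of_int (int b - int a) = (of_int (m * int N) :: real)"
      by simp
    then have eq: "int b - int a = m * int N"
      by (simp only: of_int_eq_iff)
    then have "m \<noteq> 0" using False by auto
    then have "\<bar>m\<bar> * int N \<ge> 1 * int N" by (intro mult_right_mono) auto
    moreover have "\<bar>m\<bar> * int N = \<bar>int b - int a\<bar>" using eq by (simp add: abs_mult)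
    ultimately show False using assms by auto
  qed
  moreover have "w ^ N = 1"
  proof -
    have "w ^ N = cis (2 * pi * of_int (int b - int a))"
      unfolding w_def Complex.DeMoivre using N by (intro arg_cong [where f = cis]) simp
    also have "\<dots> = 1" by (intro cis_multiple_2pi) simp
    finally show ?thesis .
  qed
  moreover have "(\<Sum>l<N. cis (2 * pi * (real b - real a) * real l / real N)) = (\<Sum>l<N. w ^ l)"
    unfolding w_def Complex.DeMoivre by (intro sum.cong refl arg_cong [where f = cis]) simp
  ultimately show ?thesis
    using False by (simp add: geometric_sum)
qed simp

text \<open>Each entry of the product is a sum of roots of unity over the ranks. Reindexing by rank
  makes orthogonality of the characters applicable.\<close>

lemma dft_unitary:
  "(dft :: complex^('n::{finite,linorder})^('n::{finite,linorder})) ** herm dft = mat 1"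
proof -
  let ?r = "\<lambda>i::'n. card {l. l < i}" and ?N = "CARD('n)"
  have r: "?r i < ?N" for i
    using card_less_bij [where ?'n = 'n] by (auto simp: bij_betw_def)
  have inj: "?r i = ?r j \<longleftrightarrow> i = j" for i j
    using card_less_bij [where ?'n = 'n] by (auto simp: bij_betw_def dest: injD)
  have "(dft ** herm dft) $ i $ j = mat 1 $ i $ j" for i j :: 'n
  proof -
    have sq: "complex_of_real (sqrt ?N) * complex_of_real (sqrt ?N) = of_nat ?N"
      by (simp flip: of_real_mult)
    have "(dft ** herm dft) $ i $ j
        = (\<Sum>l\<in>UNIV. cis (2 * pi * (real (?r j) - real (?r i)) * real (?r l) / real ?N)) / of_nat ?N"
      unfolding matrix_matrix_mult_def dft_def sum_divide_distrib
      by (auto intro!: sum.cong simp: sq cis_cnj cis_mult field_simps)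
    also have "(\<Sum>l\<in>UNIV. cis (2 * pi * (real (?r j) - real (?r i)) * real (?r l) / real ?N))
        = (\<Sum>l<?N. cis (2 * pi * (real (?r j) - real (?r i)) * real l / real ?N))"
      by (rule sum.reindex_bij_betw [OF card_less_bij])
    also have "\<dots> = (if ?r i = ?r j then of_nat ?N else 0)"
      by (rule sum_cis_roots_of_unity [OF r r])
    finally show ?thesis by (simp add: inj mat_def)
  qed
  then show ?thesis by (simp add: vec_eq_iff)
qed

section \<open>Quadratic forms and block embeddings\<close>

lemma scalar_product_matrix_vector: "scalar_product x (A *v y) = scalar_product (transpose A *v x) y"
  for A :: "complex^'j^'i"
  unfolding scalar_product_def matrix_vector_mult_def transpose_def
  by (simp add: sum_distrib_left sum_distrib_right mult_ac) (rule sum.swap)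

lemma herm_vector_mult: "herm A *v conj_vec x = conj_vec (transpose A *v x)"
  by (simp add: vec_eq_iff conj_vec_def matrix_vector_mult_def transpose_def)

text \<open>The form conjugates its right argument, so a gain moves onto the vector as a transpose,
  not as a conjugate transpose.\<close>

lemma qform_congruence: "qform x (A ** B ** herm A) = qform (transpose A *v x) B"
  by (simp add: qform_def herm_vector_mult scalar_product_matrix_vector
      flip: matrix_vector_mul_assoc)

lemma qform_add: "qform x (A + B) = qform x A + qform x B"
  by (simp add: qform_def scalar_product_def matrix_vector_mult_add_rdistrib sum.distrib
      distrib_left)

lemma qform_scaleR: "qform x (c *\<^sub>R A) = of_real c * qform x A"
  by (simp add: qform_def scalar_product_def matrix_vector_mult_def sum_distrib_left
      scaleR_conv_of_real [where 'a = complex] mult_ac)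

lemma qform_sum: "qform x (\<Sum>i\<in>I. f i) = (\<Sum>i\<in>I. qform x (f i))"
  by (induction I rule: infinite_finite_induct)
    (simp_all add: qform_add, simp_all add: qform_def scalar_product_def)

lemma qform_scaleR_vec: "qform (c *\<^sub>R x) A = of_real (c\<^sup>2) * qform x A"
  by (simp add: qform_def scalar_product_def conj_vec_def matrix_vector_mult_def sum_distrib_left
      scaleR_conv_of_real [where 'a = complex] power2_eq_square mult_ac)

lemma qform_diag_vec: "qform x (diag_vec a) = (\<Sum>i\<in>UNIV. a $ i * of_real ((cmod (x $ i))\<^sup>2))"
  by (simp add: qform_def scalar_product_def diag_vec_vector_mult conj_vec_def
      complex_norm_square mult_ac del: of_real_power)

lemma qform_outer: "qform x (outer h) = of_real ((cmod (scalar_product x h))\<^sup>2)"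
  unfolding complex_norm_square cnj_sum sum_product qform_def scalar_product_def
  by (simp add: conj_vec_def matrix_vector_mult_def sum_distrib_left mult_ac)

lemma scalar_product_block_embed:
  "scalar_product (block_embed n x) (block_embed n y) = scalar_product x y"
proof -
  have "scalar_product (block_embed n x) (block_embed n y)
      = (\<Sum>j\<in>UNIV. \<Sum>m\<in>UNIV. if j = n then x $ m * y $ m else 0)"
    unfolding scalar_product_def UNIV_Times_UNIV [symmetric] sum.cartesian_product
    by (intro sum.cong) auto
  also have "\<dots> = scalar_product x y"
    by (subst sum.swap) (simp add: scalar_product_def)
  finally show ?thesis .
qed

text \<open>Only the \<open>n\<close>-th block is nonzero, and the weight depends on the antenna
  alone.\<close>

lemma sum_block_embed:
  "(\<Sum>i\<in>UNIV. f (snd i) * of_real ((cmod (block_embed n x $ i))\<^sup>2))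
    = (\<Sum>m\<in>UNIV. f m * complex_of_real ((cmod (x $ m))\<^sup>2))"
proof -
  have "(\<Sum>i\<in>UNIV. f (snd i) * of_real ((cmod (block_embed n x $ i))\<^sup>2))
      = (\<Sum>j\<in>UNIV. \<Sum>m\<in>UNIV. if j = n then f m * complex_of_real ((cmod (x $ m))\<^sup>2) else 0)"
    unfolding UNIV_Times_UNIV [symmetric] sum.cartesian_product
    by (intro sum.cong) auto
  also have "\<dots> = (\<Sum>m\<in>UNIV. f m * complex_of_real ((cmod (x $ m))\<^sup>2))"
    by (subst sum.swap) simp
  finally show ?thesis .
qed

lemma herm_mult: "herm (A ** B) = herm B ** herm A"
  by (simp add: vec_eq_iff matrix_matrix_mult_def mult.commute)

lemma mat_vector_mult: "mat (complex_of_real c) *v x = c *\<^sub>R x"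
  by (simp add: mat_eq_diag_vec diag_vec_vector_mult vec_eq_iff)
    (simp add: scaleR_conv_of_real [where 'a = complex])

section \<open>Closed forms of the two ratios\<close>

lemma zeta_pos:
  assumes "b > 0"
  shows "zeta b > 0"
proof (cases b)
  case (enat r)
  with assms have "r > 0" by (simp add: zero_enat_def)
  then have "(2::real) ^ 1 \<le> 2 ^ r" by (intro power_increasing) auto
  then have "sin (pi / 2 ^ r) > 0"
    by (intro sin_gt_zero) (simp_all add: field_simps)
  with enat show ?thesis by (simp add: zeta_def)
qed (simp add: zeta_def)

text \<open>Since sin x is at most x, every finite resolution is bounded by the unquantized value
  sqrt (pi / 4), which is below 1.\<close>

lemma zeta_le_one: "zeta b \<le> 1"
proof -
  have pi4: "sqrt (pi / 4) \<le> 1"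
    using pi_less_4 by simp
  show ?thesis
  proof (cases b)
    case (enat r)
    have "zeta b \<le> 2 ^ r / (2 * sqrt pi) * (pi / 2 ^ r)"
      unfolding zeta_def enat enat.case by (intro mult_left_mono sin_x_le_x) simp_all
    also have "\<dots> = sqrt (pi / 4)"
      by (simp add: real_sqrt_divide field_simps)
    finally show ?thesis using pi4 by (rule order_trans)
  qed (use pi4 in \<open>simp add: zeta_def\<close>)
qed

text \<open>The product is bilinear, without conjugation, so this is the real value of the form of
  \<open>x\<close> in the rank-one matrix \<open>outer h\<close>.\<close>

definition gain :: "complex^'m \<Rightarrow> complex^'m \<Rightarrow> real" where
  "gain x h = (cmod (scalar_product x h))\<^sup>2"

text \<open>For nonnegative \<open>p\<close>, the \<open>m\<close>-th diagonal entry of the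
  covariance averaged over the sub-carriers. It serves the transmit side with the beamformers and
  the receive side with the channels.\<close>

definition avg_power ::
    "('k::finite \<Rightarrow> 'n::finite \<Rightarrow> complex^'m) \<Rightarrow> real^('k \<times> 'n) \<Rightarrow> 'm \<Rightarrow> real" where
  "avg_power x p m = (\<Sum>n\<in>UNIV. \<Sum>k\<in>UNIV. p $ (k, n) * (cmod (x k n $ m))\<^sup>2) / real CARD('n)"

text \<open>The form of \<open>x\<close> in the diagonal part of \<open>outer y\<close>. Its
  symmetry in \<open>x\<close> and \<open>y\<close> lets one quantization coupling matrix serve the
  downlink by rows and the uplink by columns.\<close>

definition joint_power :: "complex^'m \<Rightarrow> complex^'m \<Rightarrow> real" where
  "joint_power x y = (\<Sum>m\<in>UNIV. (cmod (x $ m))\<^sup>2 * (cmod (y $ m))\<^sup>2)"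

lemma joint_power_commute: "joint_power x y = joint_power y x"
  by (simp add: joint_power_def mult.commute)

lemma qform_block_embed_outer:
  "qform (block_embed n x) (outer (block_embed n h)) = of_real (gain x h)"
  by (simp add: qform_outer scalar_product_block_embed gain_def)

lemma avg_power_nonneg:
  assumes "\<And>k n. p $ (k, n) \<ge> 0"
  shows "avg_power x p m \<ge> 0"
  unfolding avg_power_def using assms by (simp add: sum_nonneg)

text \<open>Exchanging the sum over antennas with the sum over users and sub-carriers turns a noise
  power into a linear function of the power vector, with the coefficients found in
  \<open>Phi_mat\<close>.\<close>

lemma sum_avg_power:
  fixes x :: "'k::finite \<Rightarrow> 'n::finite \<Rightarrow> complex^'m"
  shows "(\<Sum>m\<in>UNIV. (cmod (y $ m))\<^sup>2 * avg_power x p m)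
    = (\<Sum>(k, n)\<in>UNIV. p $ (k, n) * joint_power (x k n) y) / real CARD('n)"
proof -
  have "(\<Sum>m\<in>UNIV. (cmod (y $ m))\<^sup>2 * avg_power x p m)
      = (\<Sum>m\<in>UNIV. \<Sum>(k, n)\<in>UNIV. p $ (k, n) * ((cmod (x k n $ m))\<^sup>2 * (cmod (y $ m))\<^sup>2)) / real CARD('n)"
    unfolding avg_power_def UNIV_Times_UNIV [symmetric] sum.cartesian_product [symmetric]
    by (subst (2) sum.swap) (simp add: sum_distrib_left sum_divide_distrib mult_ac)
  also have "(\<Sum>m\<in>UNIV. \<Sum>(k, n)\<in>UNIV. p $ (k, n) * ((cmod (x k n $ m))\<^sup>2 * (cmod (y $ m))\<^sup>2))
      = (\<Sum>(k, n)\<in>UNIV. p $ (k, n) * joint_power (x k n) y)"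
    unfolding joint_power_def
    by (subst sum.swap) (simp add: case_prod_beta sum_distrib_left)
  finally show ?thesis .
qed

section \<open>Diagonal covariances and Bussgang gains\<close>

lemma cov_diag_entry:
  assumes "\<And>k. p $ (k, n) \<ge> 0"
  shows "(cols x n ** sqrt_power p n ** herm (sqrt_power p n) ** herm (cols x n)) $ m $ m
    = of_real (\<Sum>k\<in>UNIV. p $ (k, n) * (cmod (x k n $ m))\<^sup>2)"
proof -
  have sq: "complex_of_real (sqrt (p $ (k, n))) * complex_of_real (sqrt (p $ (k, n)))
      = of_real (p $ (k, n))" for k
    using assms [of k] by (simp flip: of_real_mult)
  have "sqrt_power p n ** herm (sqrt_power p n) = diag_vec (\<chi> k. of_real (p $ (k, n)))"
    by (simp add: sqrt_power_def herm_diag_vec diag_vec_mult conj_vec_def sq)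
  then have "cols x n ** sqrt_power p n ** herm (sqrt_power p n) ** herm (cols x n)
      = cols x n ** diag_vec (\<chi> k. of_real (p $ (k, n))) ** herm (cols x n)"
    by (simp flip: matrix_mul_assoc)
  also have "\<dots> $ m $ m = (\<Sum>k\<in>UNIV. x k n $ m * of_real (p $ (k, n)) * cnj (x k n $ m))"
    by (simp add: matrix_matrix_mult_def cols_def if_distrib [of "\<lambda>x. _ * x"] cong: if_cong)
  finally show ?thesis
    by (simp add: complex_norm_square mult_ac del: of_real_power)
qed

lemma tx_cov_diag_entry:
  fixes t :: "'k::finite \<Rightarrow> 'n::finite \<Rightarrow> complex^'m"
  assumes "\<And>k n. q $ (k, n) \<ge> 0"
  shows "tx_cov t q $ m $ m = of_real (real CARD('n) * avg_power t q m)"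
  unfolding tx_cov_def sum_component by (simp add: cov_diag_entry assms avg_power_def)

lemma rx_cov_diag_entry:
  fixes h :: "'k::finite \<Rightarrow> 'n::finite \<Rightarrow> complex^'m"
  assumes "\<And>k n. p $ (k, n) \<ge> 0"
  shows "rx_cov \<sigma> h p $ m $ m = of_real (real CARD('n) * (avg_power h p m + \<sigma>\<^sup>2))"
  unfolding rx_cov_def sum_component vector_add_component
  by (simp add: cov_diag_entry assms avg_power_def sum.distrib mat_def distrib_left
      scaleR_conv_of_real [where 'a = complex])

lemma tx_scale:
  fixes t :: "'k::finite \<Rightarrow> 'n::finite \<Rightarrow> complex^'m"
  assumes "\<And>k n. q $ (k, n) \<ge> 0"
  shows "diag_sqrt (diag_part ((1 / real CARD('n)) *\<^sub>R tx_cov t q))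
    = diag_vec (\<chi> m. of_real (sqrt (avg_power t q m)))"
  using avg_power_nonneg [OF assms, of t]
  by (simp add: diag_sqrt_def diag_part_def tx_cov_diag_entry assms)

lemma rx_scale:
  fixes h :: "'k::finite \<Rightarrow> 'n::finite \<Rightarrow> complex^'m"
  assumes "\<And>k n. p $ (k, n) \<ge> 0"
  shows "diag_sqrt (diag_part ((1 / real CARD('n)) *\<^sub>R rx_cov \<sigma> h p))
    = diag_vec (\<chi> m. of_real (sqrt (avg_power h p m + \<sigma>\<^sup>2)))"
proof -
  have "csqrt (of_real (avg_power h p m) + (of_real \<sigma>)\<^sup>2) = of_real (sqrt (avg_power h p m + \<sigma>\<^sup>2))" for m
    using csqrt_of_real_nonneg [of "of_real (avg_power h p m + \<sigma>\<^sup>2)"]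
      avg_power_nonneg [OF assms, of h m] by simp
  then show ?thesis
    by (simp add: diag_sqrt_def diag_part_def rx_cov_diag_entry assms)
      (simp add: scaleR_conv_of_real [where 'a = complex])
qed

text \<open>The power allocation is the square root of the very diagonal whose inverse square root
  enters the Bussgang gain; only the quantizer constant survives.\<close>

lemma A_d_Q_PA:
  fixes t :: "'k::finite \<Rightarrow> 'n::finite \<Rightarrow> complex^'m"
  assumes "\<And>k n. q $ (k, n) \<ge> 0" and "\<And>m. avg_power t q m > 0"
  shows "A_d b t q ** Q_PA t q = mat (of_real (zeta b))"
proof -
  have nz: "avg_power t q m \<noteq> 0" for m using assms(2) [of m] by simp
  have "zeta b *\<^sub>R diag_vec (\<chi> m. inverse (complex_of_real (sqrt (avg_power t q m))))
      = diag_vec (\<chi> m. of_real (zeta b) * inverse (complex_of_real (sqrt (avg_power t q m))))"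
    by (simp add: vec_eq_iff scaleR_conv_of_real [where 'a = complex])
  then show ?thesis
    by (simp add: A_d_def Q_PA_def tx_scale assms(1) matrix_inv_diag_vec nz kron_mult diag_vec_mult
        mat_eq_diag_vec [symmetric] mult.assoc kron_mat)
qed

lemma trace_diag_vec_mult: "trace (diag_vec d ** A) = (\<Sum>i\<in>UNIV. d $ i * A $ i $ i)"
  by (simp add: trace_def matrix_matrix_mult_def if_distrib [of "\<lambda>x. x * _"] cong: if_cong)

text \<open>The DFT acts on the sub-carrier factor and the noise shaping on the antenna factor, so
  the two commute and the DFT cancels by unitarity. The remaining matrix is diagonal, hence the
  trace sees only the squared moduli of \<open>x\<close>.\<close>

lemma tx_noise_power:
  fixes t :: "'k::finite \<Rightarrow> 'n::{finite,linorder} \<Rightarrow> complex^'m" and n :: 'n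
  assumes "\<And>k n. q $ (k, n) \<ge> 0"
  shows "trace (W_dft ** Q_PA t q ** R_eta b ** herm (Q_PA t q) ** herm W_dft
      ** map_matrix cnj (outer (block_embed n x)))
    = of_real ((1 - (zeta b)\<^sup>2) * (\<Sum>m\<in>UNIV. (cmod (x $ m))\<^sup>2 * avg_power t q m))"
proof -
  have sq: "complex_of_real (sqrt (avg_power t q m)) * c * complex_of_real (sqrt (avg_power t q m))
      = c * of_real (avg_power t q m)" for m c
    using avg_power_nonneg [OF assms, of t m]
    by (simp add: mult.assoc mult.left_commute [of _ c] flip: of_real_mult)
  have "W_dft ** Q_PA t q ** R_eta b ** herm (Q_PA t q) ** herm W_dft
      = diag_vec (\<chi> i. of_real ((1 - (zeta b)\<^sup>2) * avg_power t q (snd i)))"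
    unfolding W_dft_def Q_PA_def R_eta_def tx_scale [OF assms] kron_mat [symmetric] herm_kron
      kron_mult
    \<comment> \<open>The instantiation rewrites only the scalar noise covariance and leaves the
      identity factors intact for \<open>dft_unitary\<close>.\<close>
    unfolding mat_eq_diag_vec [of "complex_of_real _"]
    by (simp add: herm_mat dft_unitary herm_diag_vec diag_vec_mult kron_mat_diag_vec conj_vec_def sq)
  then show ?thesis
    using sum_block_embed [of "\<lambda>m. of_real ((1 - (zeta b)\<^sup>2) * avg_power t q m)" n x]
    by (simp add: trace_diag_vec_mult map_matrix_def complex_norm_square sum_distrib_left mult_ac
        del: of_real_power)
qed

lemma gamma_DL_eq:
  fixes t :: "'k::finite \<Rightarrow> 'n::{finite,linorder} \<Rightarrow> complex^'m"
  assumes "\<And>k n. q $ (k, n) \<ge> 0" and "\<And>m. avg_power t q m > 0"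
  shows "gamma_DL b \<sigma> h t (Q_PA t q) q k n = of_real
    (q $ (k, n) * ((zeta b)\<^sup>2 * gain (t k n) (h k n))
     / ((\<Sum>i\<in>UNIV - {k}. q $ (i, n) * ((zeta b)\<^sup>2 * gain (t i n) (h k n))) + \<sigma>\<^sup>2
        + (1 - (zeta b)\<^sup>2) * (\<Sum>m\<in>UNIV. (cmod (h k n $ m))\<^sup>2 * avg_power t q m)))"
proof -
  let ?A = "A_d b t q" and ?Q = "Q_PA t q"
  have "?A ** ?Q ** R ** herm ?Q ** herm ?A = (?A ** ?Q) ** R ** herm (?A ** ?Q)" for R
    by (simp add: herm_mult matrix_mul_assoc)
  then have "qform (block_embed n (t i n))
        (?A ** ?Q ** outer (block_embed n (h k n)) ** herm ?Q ** herm ?A)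
      = of_real ((zeta b)\<^sup>2 * gain (t i n) (h k n))" for i
    by (simp add: A_d_Q_PA assms qform_congruence mat_vector_mult transpose_mat qform_scaleR_vec
        qform_block_embed_outer)
  then show ?thesis
    by (simp add: gamma_DL_def Let_def tx_noise_power assms(1))
qed

lemma A_u_diag_vec:
  fixes h :: "'k::finite \<Rightarrow> 'n::finite \<Rightarrow> complex^'m"
  assumes "\<And>k n. p $ (k, n) \<ge> 0" and "\<sigma>\<^sup>2 > 0"
  shows "A_u b \<sigma> h p
    = diag_vec (\<chi> i. of_real (zeta b / sqrt (avg_power h p (snd i) + \<sigma>\<^sup>2)))"
proof -
  have nz: "avg_power h p m + \<sigma>\<^sup>2 \<noteq> 0" for m
    using avg_power_nonneg [OF assms(1), of h m] assms(2) by linarith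
  have nz': "complex_of_real (sqrt (avg_power h p m + \<sigma>\<^sup>2)) \<noteq> 0" for m
    using nz [of m] by (simp del: of_real_add)
  have "zeta b *\<^sub>R diag_vec (\<chi> m. inverse (complex_of_real (sqrt (avg_power h p m + \<sigma>\<^sup>2))))
      = diag_vec (\<chi> m. complex_of_real (zeta b / sqrt (avg_power h p m + \<sigma>\<^sup>2)))"
    by (simp add: vec_eq_iff scaleR_conv_of_real [where 'a = complex] divide_inverse)
  then show ?thesis
    by (simp only: A_u_def rx_scale assms(1)) (simp add: matrix_inv_diag_vec nz kron_mat_diag_vec)
qed

text \<open>With \<open>A *v u\<close> equal to \<open>s\<close> times the embedded beamformer,
  every term carries the factor \<open>s\<^sup>2\<close>, which cancels. Quantization noise does not
  pass through \<open>A\<close>, so there \<open>u\<close> is recovered by dividing by the gains;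
  this brings in the antenna powers.\<close>

lemma gamma_UL_eq:
  fixes h t :: "'k::finite \<Rightarrow> 'n::{finite,linorder} \<Rightarrow> complex^'m"
  assumes p: "\<And>k n. p $ (k, n) \<ge> 0" and \<sigma>: "\<sigma>\<^sup>2 > 0" and \<zeta>: "zeta b > 0"
    and t: "norm (t k n) = 1"
    and u: "block_embed n (t k n) = (1 / norm (A_u b \<sigma> h p *v u)) *\<^sub>R (A_u b \<sigma> h p *v u)"
  shows "gamma_UL b \<sigma> h u p k n = of_real
    (p $ (k, n) * gain (t k n) (h k n)
     / ((\<Sum>i\<in>UNIV - {k}. p $ (i, n) * gain (t k n) (h i n)) + \<sigma>\<^sup>2
        + (1 / (zeta b)\<^sup>2 - 1) * (\<Sum>m\<in>UNIV. (cmod (t k n $ m))\<^sup>2 * (avg_power h p m + \<sigma>\<^sup>2))))"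
proof -
  define A where "A = A_u b \<sigma> h p"
  define s where "s = norm (A *v u)"
  let ?t = "block_embed n (t k n)" and ?v = "\<lambda>m. avg_power h p m + \<sigma>\<^sup>2"
  have A: "A = diag_vec (\<chi> i. of_real (zeta b / sqrt (?v (snd i))))"
    unfolding A_def by (rule A_u_diag_vec [OF p \<sigma>])
  have v: "?v m > 0" for m using avg_power_nonneg [OF p, of h m] \<sigma> by linarith
  have "?t \<noteq> 0"
  proof
    assume "?t = 0"
    then have "t k n $ m = 0" for m by (metis block_embed_nth fst_conv snd_conv zero_index)
    then have "t k n = 0" by (simp add: vec_eq_iff)
    with t show False by simp
  qed
  \<comment> \<open>If \<open>s\<close> were 0, the normalized vector in \<open>u\<close> would be
    0, unlike the embedded unit-norm beamformer.\<close>
  then have s: "s \<noteq> 0" using u unfolding s_def A_def by auto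
  then have Au: "A *v u = s *\<^sub>R ?t" using u unfolding s_def A_def by simp
  have norm_t: "(\<Sum>m\<in>UNIV. (cmod (t k n $ m))\<^sup>2) = 1"
    using t by (simp add: norm_vec_def L2_set_def)
  have qf: "qform u (A ** R ** herm A) = of_real (s\<^sup>2) * qform ?t R" for R
  proof -
    have "transpose A = A" unfolding A by (rule transpose_diag_vec)
    then show ?thesis by (simp only: qform_congruence Au qform_scaleR_vec)
  qed
  have thermal: "qform u (A ** herm A) = of_real (s\<^sup>2)"
  proof -
    have "qform u (A ** herm A) = of_real (s\<^sup>2) * qform ?t (mat 1)"
      using qf [of "mat 1"] by simp
    also have "qform ?t (mat 1) = 1"
      using sum_block_embed [of "\<lambda>_. 1" n "t k n"] norm_t
      by (simp add: mat_eq_diag_vec qform_diag_vec flip: of_real_power of_real_sum)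
    finally show ?thesis by simp
  qed
  have u_nth: "of_real ((cmod (u $ i))\<^sup>2)
      = of_real (s\<^sup>2 / (zeta b)\<^sup>2 * ?v (snd i)) * complex_of_real ((cmod (?t $ i))\<^sup>2)" for i
  proof -
    have "of_real (zeta b / sqrt (?v (snd i))) * u $ i = of_real s * ?t $ i"
      using arg_cong [OF Au, of "\<lambda>x. x $ i"]
      by (simp add: A diag_vec_vector_mult scaleR_conv_of_real [where 'a = complex])
    then have "(zeta b / sqrt (?v (snd i)))\<^sup>2 * (cmod (u $ i))\<^sup>2 = s\<^sup>2 * (cmod (?t $ i))\<^sup>2"
      by (metis norm_mult norm_of_real power_mult_distrib power2_abs)
    then have "(cmod (u $ i))\<^sup>2 = s\<^sup>2 / (zeta b)\<^sup>2 * ?v (snd i) * (cmod (?t $ i))\<^sup>2"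
      using \<zeta> v [of "snd i"] by (simp add: power_divide field_simps)
    then show ?thesis by (metis of_real_mult)
  qed
  have quant: "qform u (W_dft ** R_eta b ** herm W_dft)
      = of_real (s\<^sup>2 * ((1 / (zeta b)\<^sup>2 - 1) * (\<Sum>m\<in>UNIV. (cmod (t k n $ m))\<^sup>2 * ?v m)))"
  proof -
    have "W_dft ** R_eta b ** herm W_dft = (mat (of_real (1 - (zeta b)\<^sup>2)) :: complex^('n \<times> 'm)^('n \<times> 'm))"
      unfolding W_dft_def R_eta_def kron_mat [symmetric] herm_kron kron_mult
      by (simp add: herm_mat dft_unitary)
    then have "qform u (W_dft ** R_eta b ** herm W_dft)
        = of_real (1 - (zeta b)\<^sup>2) * (\<Sum>i\<in>UNIV. of_real ((cmod (u $ i))\<^sup>2))"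
      by (simp add: mat_eq_diag_vec qform_diag_vec sum_distrib_left)
    also have "(\<Sum>i\<in>UNIV. of_real ((cmod (u $ i))\<^sup>2))
        = (\<Sum>m\<in>UNIV. of_real (s\<^sup>2 / (zeta b)\<^sup>2 * ?v m) * complex_of_real ((cmod (t k n $ m))\<^sup>2))"
      unfolding u_nth by (rule sum_block_embed)
    also have "\<dots> = of_real (s\<^sup>2 / (zeta b)\<^sup>2 * (\<Sum>m\<in>UNIV. (cmod (t k n $ m))\<^sup>2 * ?v m))"
      unfolding sum_distrib_left of_real_sum of_real_mult by (simp only: mult_ac)
    also have "of_real (1 - (zeta b)\<^sup>2) * complex_of_real (s\<^sup>2 / (zeta b)\<^sup>2 * S)
        = of_real (s\<^sup>2 * ((1 / (zeta b)\<^sup>2 - 1) * S))" for S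
      using \<zeta> unfolding of_real_mult [symmetric] of_real_eq_iff by (simp add: field_simps)
    finally show ?thesis .
  qed
  let ?I = "\<Sum>i\<in>UNIV - {k}. p $ (i, n) * gain (t k n) (h i n)"
    and ?X = "(1 / (zeta b)\<^sup>2 - 1) * (\<Sum>m\<in>UNIV. (cmod (t k n $ m))\<^sup>2 * ?v m)"
  have "gamma_UL b \<sigma> h u p k n
      = of_real (p $ (k, n)) * (of_real (s\<^sup>2) * of_real (gain (t k n) (h k n)))
        / ((\<Sum>i\<in>UNIV - {k}. of_real (p $ (i, n)) * (of_real (s\<^sup>2) * of_real (gain (t k n) (h i n))))
           + of_real (\<sigma>\<^sup>2) * of_real (s\<^sup>2) + of_real (s\<^sup>2 * ?X))"
    unfolding gamma_UL_def Let_def A_def [symmetric] qform_add qform_sum qform_scaleR qf thermal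
      quant qform_block_embed_outer ..
  also have "\<dots> = of_real (s\<^sup>2 * (p $ (k, n) * gain (t k n) (h k n)) / (s\<^sup>2 * (?I + \<sigma>\<^sup>2 + ?X)))"
    unfolding of_real_divide by (simp add: sum_distrib_left distrib_left mult_ac)
  also have "\<dots> = of_real (p $ (k, n) * gain (t k n) (h k n) / (?I + \<sigma>\<^sup>2 + ?X))"
    using s by (subst mult_divide_mult_cancel_left) simp_all
  finally show ?thesis .
qed

section \<open>Duality\<close>

lemma zeta_excess_nonneg:
  assumes "b > 0"
  shows "1 / (zeta b)\<^sup>2 - 1 \<ge> 0"
  using zeta_pos [OF assms] zeta_le_one [of b] by (simp add: power_le_one)

lemma gain_nonneg: "gain x h \<ge> 0"
  by (simp add: gain_def)

lemma joint_power_nonneg: "joint_power x y \<ge> 0"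
  by (simp add: joint_power_def sum_nonneg)

section \<open>Coupling matrices and the linear form of the targets\<close>

lemma Psi_mat_nth:
  "Psi_mat h t $ (k, n) $ (i, j) = (if j = n \<and> i \<noteq> k then gain (t i n) (h k n) else 0)"
  by (simp add: Psi_mat_def qform_outer gain_def)

lemma Phi_mat_nth:
  fixes h t :: "'k::finite \<Rightarrow> 'n::finite \<Rightarrow> complex^'m"
  shows "Phi_mat b h t $ (k, n) $ (i, j)
    = (1 / (zeta b)\<^sup>2 - 1) * joint_power (h k n) (t i j) / real CARD('n)"
proof -
  have "qform (t i j) (diag_part (outer (h k n))) = of_real (joint_power (h k n) (t i j))"
    unfolding joint_power_def
    by (simp add: diag_part_def qform_diag_vec complex_norm_square mult_ac del: of_real_power)
  then show ?thesis
    by (simp add: Phi_mat_def R_tilde_def qform_scaleR)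
qed

lemma sum_pair_column:
  fixes f :: "'k::finite \<Rightarrow> 'n::finite \<Rightarrow> real"
  shows "(\<Sum>(i, j)\<in>UNIV. if j = n \<and> i \<noteq> k then f i j else 0) = (\<Sum>i\<in>UNIV - {k}. f i n)"
proof -
  have "(\<Sum>(i, j)\<in>UNIV. if j = n \<and> i \<noteq> k then f i j else 0)
      = (\<Sum>i\<in>UNIV. \<Sum>j\<in>UNIV. if j = n then if i \<noteq> k then f i j else 0 else 0)"
    unfolding UNIV_Times_UNIV [symmetric] sum.cartesian_product by (intro sum.cong) auto
  also have "\<dots> = (\<Sum>i\<in>UNIV. if i \<noteq> k then f i n else 0)" by simp
  also have "\<dots> = (\<Sum>i\<in>UNIV - {k}. f i n)"
    by (intro sum.mono_neutral_cong_right) auto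
  finally show ?thesis .
qed

text \<open>A row collects what user \<open>k\<close> receives in the downlink: interference and
  quantization noise, both divided by the squared quantizer constant.\<close>

lemma coupling_row_sum:
  fixes h t :: "'k::finite \<Rightarrow> 'n::finite \<Rightarrow> complex^'m"
  shows "(\<Sum>y\<in>UNIV. (Psi_mat h t + Phi_mat b h t) $ (k, n) $ y * q $ y)
    = (\<Sum>i\<in>UNIV - {k}. q $ (i, n) * gain (t i n) (h k n))
      + (1 / (zeta b)\<^sup>2 - 1) * (\<Sum>m\<in>UNIV. (cmod (h k n $ m))\<^sup>2 * avg_power t q m)"
proof -
  have "(\<Sum>y\<in>UNIV. (Psi_mat h t + Phi_mat b h t) $ (k, n) $ y * q $ y)
      = (\<Sum>y\<in>UNIV. Psi_mat h t $ (k, n) $ y * q $ y) + (\<Sum>y\<in>UNIV. Phi_mat b h t $ (k, n) $ y * q $ y)"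
    by (simp add: distrib_right sum.distrib)
  also have "(\<Sum>y\<in>UNIV. Psi_mat h t $ (k, n) $ y * q $ y)
      = (\<Sum>(i, j)\<in>UNIV. if j = n \<and> i \<noteq> k then q $ (i, j) * gain (t i j) (h k n) else 0)"
    by (intro sum.cong) (auto simp: Psi_mat_nth)
  also have "(\<Sum>y\<in>UNIV. Phi_mat b h t $ (k, n) $ y * q $ y)
      = (1 / (zeta b)\<^sup>2 - 1)
        * ((\<Sum>(i, j)\<in>UNIV. q $ (i, j) * joint_power (t i j) (h k n)) / real CARD('n))"
    unfolding sum_distrib_left sum_divide_distrib
    by (intro sum.cong) (auto simp: Phi_mat_nth joint_power_commute)
  finally show ?thesis
    by (simp only: sum_pair_column sum_avg_power)
qed

text \<open>A column collects what the combiner of user \<open>k\<close> picks up in the uplink: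
  interference and the quantization noise caused by the user signals. The share caused by thermal
  noise is accounted for separately.\<close>

lemma coupling_column_sum:
  fixes h t :: "'k::finite \<Rightarrow> 'n::finite \<Rightarrow> complex^'m"
  shows "(\<Sum>y\<in>UNIV. (Psi_mat h t + Phi_mat b h t) $ y $ (k, n) * p $ y)
    = (\<Sum>i\<in>UNIV - {k}. p $ (i, n) * gain (t k n) (h i n))
      + (1 / (zeta b)\<^sup>2 - 1) * (\<Sum>m\<in>UNIV. (cmod (t k n $ m))\<^sup>2 * avg_power h p m)"
proof -
  have "(\<Sum>y\<in>UNIV. (Psi_mat h t + Phi_mat b h t) $ y $ (k, n) * p $ y)
      = (\<Sum>y\<in>UNIV. Psi_mat h t $ y $ (k, n) * p $ y) + (\<Sum>y\<in>UNIV. Phi_mat b h t $ y $ (k, n) * p $ y)"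
    by (simp add: distrib_right sum.distrib)
  also have "(\<Sum>y\<in>UNIV. Psi_mat h t $ y $ (k, n) * p $ y)
      = (\<Sum>(i, j)\<in>UNIV. if j = n \<and> i \<noteq> k then p $ (i, j) * gain (t k j) (h i j) else 0)"
    by (intro sum.cong) (auto simp: Psi_mat_nth)
  also have "(\<Sum>y\<in>UNIV. Phi_mat b h t $ y $ (k, n) * p $ y)
      = (1 / (zeta b)\<^sup>2 - 1)
        * ((\<Sum>(i, j)\<in>UNIV. p $ (i, j) * joint_power (h i j) (t k n)) / real CARD('n))"
    unfolding sum_distrib_left sum_divide_distrib
    by (intro sum.cong) (auto simp: Phi_mat_nth)
  finally show ?thesis
    by (simp only: sum_pair_column sum_avg_power)
qed

lemma D_mat_vector_mult:
  "(D_mat \<gamma> h t *v x) $ (k, n) = \<gamma> k n / gain (t k n) (h k n) * x $ (k, n)"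
  by (simp add: D_mat_def matrix_vector_mult_def qform_outer gain_def
      if_distrib [of "\<lambda>x. x * _"] cong: if_cong)

lemma coupling_vector_mult:
  "(coupling b \<gamma> h t *v x) $ (k, n)
    = x $ (k, n) - \<gamma> k n / gain (t k n) (h k n)
      * (\<Sum>y\<in>UNIV. (Psi_mat h t + Phi_mat b h t) $ y $ (k, n) * x $ y)"
proof -
  have "coupling b \<gamma> h t *v x = x - D_mat \<gamma> h t *v (transpose (Psi_mat h t + Phi_mat b h t) *v x)"
  proof -
    have "transpose (Psi_mat h t + Phi_mat b h t)
        = transpose (Psi_mat h t) + transpose (Phi_mat b h t)"
      by (simp add: vec_eq_iff transpose_def)
    then show ?thesis
      by (simp only: coupling_def matrix_vector_mult_diff_rdistrib matrix_vector_mult_add_rdistrib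
          matrix_vector_mul_assoc matrix_add_ldistrib matrix_vector_right_distrib
          matrix_vector_mul_lid diff_diff_add)
  qed
  then show ?thesis
    by (simp add: D_mat_vector_mult vector_matrix_mult_def mult.commute)
qed

lemma gamma_DL_balance:
  fixes t :: "'k::finite \<Rightarrow> 'n::{finite,linorder} \<Rightarrow> complex^'m"
  assumes b: "b > 0" and \<sigma>: "\<sigma>\<^sup>2 > 0" and \<gamma>: "\<gamma> k n > 0"
    and q: "\<And>k n. q $ (k, n) \<ge> 0" and avg: "\<And>m. avg_power t q m > 0"
    and target: "gamma_DL b \<sigma> h t (Q_PA t q) q k n = complex_of_real (\<gamma> k n)"
  shows "gain (t k n) (h k n) / \<gamma> k n * q $ (k, n)
    = (\<Sum>y\<in>UNIV. (Psi_mat h t + Phi_mat b h t) $ (k, n) $ y * q $ y) + \<sigma>\<^sup>2 / (zeta b)\<^sup>2"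
proof -
  let ?z = "(zeta b)\<^sup>2" and ?a = "gain (t k n) (h k n)"
  let ?I = "\<Sum>i\<in>UNIV - {k}. q $ (i, n) * gain (t i n) (h k n)"
    and ?X = "\<Sum>m\<in>UNIV. (cmod (h k n $ m))\<^sup>2 * avg_power t q m"
  have z: "?z > 0" using zeta_pos [OF b] by simp
  \<comment> \<open>\<open>S\<close> is the downlink denominator divided by \<open>?z\<close>; its
    positivity allows the ratio to be cleared.\<close>
  define S where "S = ?I + (1 / ?z - 1) * ?X + \<sigma>\<^sup>2 / ?z"
  have "?I \<ge> 0" "?X \<ge> 0"
    using q avg by (simp_all add: sum_nonneg gain_nonneg less_imp_le)
  then have S: "S > 0"
    unfolding S_def using zeta_excess_nonneg [OF b] z \<sigma>
    by (intro add_nonneg_pos add_nonneg_nonneg mult_nonneg_nonneg divide_pos_pos)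
  have I: "(\<Sum>i\<in>UNIV - {k}. q $ (i, n) * (?z * gain (t i n) (h k n))) = ?z * ?I"
    by (simp add: sum_distrib_left mult_ac)
  have "\<gamma> k n = q $ (k, n) * (?z * ?a) / (?z * ?I + \<sigma>\<^sup>2 + (1 - ?z) * ?X)"
    using target unfolding gamma_DL_eq [OF q avg] I of_real_eq_iff by simp
  also have "?z * ?I + \<sigma>\<^sup>2 + (1 - ?z) * ?X = ?z * S"
    unfolding S_def using z by (simp add: algebra_simps)
  also have "q $ (k, n) * (?z * ?a) / (?z * S) = q $ (k, n) * ?a / S"
    using z by simp
  finally have "?a / \<gamma> k n * q $ (k, n) = S"
    using \<gamma> S by (simp add: field_simps)
  then show ?thesis unfolding coupling_row_sum S_def .
qed

theorem mainTheorem1: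
  fixes b :: enat and \<sigma> :: real
    and h t :: "'k::finite \<Rightarrow> 'n::{finite,linorder} \<Rightarrow> complex^'m"
    and q p :: "real^('k \<times> 'n)"
    and \<gamma> :: "'k \<Rightarrow> 'n \<Rightarrow> real"
  assumes "b > 0"
    and "\<sigma>\<^sup>2 > 0"
    and "\<And>k n. \<gamma> k n > 0"
    and "\<And>k n. norm (t k n) = 1"
    and "\<And>k n. q $ (k, n) \<ge> 0"
    and "invertible (diag_part (tx_cov t q))"
    and "\<And>k n. gamma_DL b \<sigma> h t (Q_PA t q) q k n = complex_of_real (\<gamma> k n)"
  defines "p \<equiv> ul_power b \<sigma> \<gamma> h t"
  shows "invertible (coupling b \<gamma> h t)
    \<and> (\<forall>k n. p $ (k, n) \<ge> 0)
    \<and> (\<forall>u :: 'k \<Rightarrow> 'n \<Rightarrow> complex^'m.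
         (\<forall>k n. u k n \<noteq> 0
            \<and> block_embed n (t k n) = (1 / norm (A_u b \<sigma> h p *v block_embed n (u k n)))
                                  *\<^sub>R (A_u b \<sigma> h p *v block_embed n (u k n)))
         \<longrightarrow> (\<forall>k n. gamma_UL b \<sigma> h (block_embed n (u k n)) p k n = complex_of_real (\<gamma> k n)))
    \<and> norm1 p = norm1 q"
proof -
  define E where "E z y = (Psi_mat h t + Phi_mat b h t) $ z $ y" for z y
  define a where "a k n = gain (t k n) (h k n)" for k n
  define d where "d = (\<lambda>(k, n). a k n / \<gamma> k n)"
  define c where "c = \<sigma>\<^sup>2 / (zeta b)\<^sup>2"
  let ?C = "coupling b \<gamma> h t"
  have \<zeta>: "zeta b > 0" using assms(1) by (rule zeta_pos)
  have c: "c > 0" unfolding c_def using \<zeta> assms(2) by simp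
  have E_nonneg: "E z y \<ge> 0" for z y
    unfolding E_def using zeta_excess_nonneg [OF assms(1)]
    by (cases z; cases y)
      (simp only: vector_add_component Psi_mat_nth Phi_mat_nth,
        simp add: gain_nonneg joint_power_nonneg)
  \<comment> \<open>Invertibility of the diagonal part excludes 0, and nonnegativity of
    \<open>q\<close> excludes negative values.\<close>
  have avg: "avg_power t q m > 0" for m
  proof -
    have "avg_power t q m \<noteq> 0"
      using invertible_diag_vec_nonzero [OF assms(6) [unfolded diag_part_def], of m]
      by (simp add: tx_cov_diag_entry assms(5))
    with avg_power_nonneg [OF assms(5), of t m] show ?thesis by simp
  qed
  have balance: "d z * q $ z = (\<Sum>y\<in>UNIV. E z y * q $ y) + c" for z
  proof (cases z)
    case (Pair k n)
    show ?thesis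
      unfolding Pair d_def E_def a_def c_def prod.case
      by (rule gamma_DL_balance [OF assms(1,2,3,5) avg assms(7)])
  qed
  have q_nonneg: "q $ z \<ge> 0" for z by (cases z) (simp add: assms(5))
  \<comment> \<open>The thermal term \<open>c\<close> bounds this product away from 0, which forces
    both the power and the effective channel gain to be positive; \<open>D_mat\<close> thus involves
    no division by zero.\<close>
  have dq: "d z * q $ z > 0" for z
    unfolding balance using c by (intro add_nonneg_pos sum_nonneg mult_nonneg_nonneg E_nonneg q_nonneg)
  have a_nonneg: "a k n \<ge> 0" for k n unfolding a_def by (rule gain_nonneg)
  have q_pos: "q $ z > 0" for z
    using dq [of z] q_nonneg [of z] by (cases "q $ z = 0") auto
  have a: "a k n > 0" for k n
    using dq [of "(k, n)"] a_nonneg [of k n] by (cases "a k n = 0") (auto simp: d_def)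
  have d: "d z > 0" for z
    unfolding d_def using a assms(3) by (cases z) simp
  \<comment> \<open>The numbers \<open>d z\<close> are the reciprocals of the diagonal of
    \<open>D_mat\<close>, so scaling by them exposes the transposed coupling, whose kernel is
    controlled by the downlink balance.\<close>
  have scaled: "d z * (?C *v x) $ z = d z * x $ z - (\<Sum>y\<in>UNIV. E y z * x $ y)" for x z
  proof (cases z)
    case (Pair k n)
    with a [of k n] assms(3) [of k n] show ?thesis
      by (simp add: coupling_vector_mult E_def d_def right_diff_distrib flip: a_def)
  qed
  have "x = 0" if "?C *v x = 0" for x
  proof -
    have "d z * x $ z = (\<Sum>y\<in>UNIV. E y z * x $ y)" for z
      using scaled [of z x] that by simp
    then have "x $ z = 0" for z
      using q_pos c balance E_nonneg d
      by (intro dominance_kernel [of "($) q" "\<lambda>_. c" d E "($) x"]) (simp_all add: less_imp_le)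
    then show ?thesis by (simp add: vec_eq_iff)
  qed
  then have inv: "invertible ?C"
    unfolding invertible_left_inverse matrix_left_invertible_ker by blast
  have "?C ** matrix_inv ?C = mat 1"
    using inv unfolding invertible_def by (metis matrix_inv_eqI)
  then have "?C *v p = c *\<^sub>R (D_mat \<gamma> h t *v 1)"
    unfolding p_def ul_power_def c_def
    by (simp add: matrix_vector_mult_scaleR matrix_vector_mul_assoc matrix_mul_assoc)
  then have "d z * (?C *v p) $ z = c" for z
    using a [of "fst z" "snd z"] assms(3) [of "fst z" "snd z"]
    by (cases z) (simp add: D_mat_vector_mult d_def flip: a_def)
  then have ul_balance: "d z * p $ z = (\<Sum>y\<in>UNIV. E y z * p $ y) + c" for z
    using scaled [of z p] by simp
  have p_nonneg: "p $ z \<ge> 0" for z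
    using q_pos c balance E_nonneg ul_balance
    by (intro dominance_nonneg [of "($) q" "\<lambda>_. c" d E "\<lambda>_. c" "($) p"]) (simp_all add: less_imp_le)
  have "c * (\<Sum>z\<in>UNIV. p $ z) = c * (\<Sum>z\<in>UNIV. q $ z)"
  proof -
    have "c * (\<Sum>z\<in>UNIV. p $ z) = (\<Sum>z\<in>UNIV. (d z * q $ z - (\<Sum>y\<in>UNIV. E z y * q $ y)) * p $ z)"
      by (simp add: balance sum_distrib_left)
    also have "\<dots> = (\<Sum>z\<in>UNIV. d z * q $ z * p $ z) - (\<Sum>z\<in>UNIV. \<Sum>y\<in>UNIV. E z y * q $ y * p $ z)"
      by (simp add: left_diff_distrib sum_subtractf sum_distrib_right)
    \<comment> \<open>A scalar equals its transpose: the row coupling of the downlink becomes the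
      column coupling of the uplink.\<close>
    also have "(\<Sum>z\<in>UNIV. \<Sum>y\<in>UNIV. E z y * q $ y * p $ z) = (\<Sum>z\<in>UNIV. \<Sum>y\<in>UNIV. E y z * p $ y * q $ z)"
      by (subst sum.swap) (simp add: mult_ac)
    also have "(\<Sum>z\<in>UNIV. d z * q $ z * p $ z) - \<dots>
        = (\<Sum>z\<in>UNIV. (d z * p $ z - (\<Sum>y\<in>UNIV. E y z * p $ y)) * q $ z)"
      by (simp only: left_diff_distrib sum_subtractf sum_distrib_right, simp only: mult_ac)
    also have "\<dots> = c * (\<Sum>z\<in>UNIV. q $ z)"
      by (simp add: ul_balance sum_distrib_left)
    finally show ?thesis .
  qed
  then have norms: "norm1 p = norm1 q"
    using c p_nonneg q_nonneg by (simp add: norm1_def)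
  have ul: "gamma_UL b \<sigma> h v p k n = complex_of_real (\<gamma> k n)"
    if v: "block_embed n (t k n) = (1 / norm (A_u b \<sigma> h p *v v)) *\<^sub>R (A_u b \<sigma> h p *v v)"
    for v k n
  proof -
    let ?I = "\<Sum>i\<in>UNIV - {k}. p $ (i, n) * gain (t k n) (h i n)"
      and ?X = "\<Sum>m\<in>UNIV. (cmod (t k n $ m))\<^sup>2 * avg_power h p m"
    have "(\<Sum>m\<in>UNIV. (cmod (t k n $ m))\<^sup>2) = 1"
      using assms(4) [of k n] by (simp add: norm_vec_def L2_set_def)
    then have "(\<Sum>m\<in>UNIV. (cmod (t k n $ m))\<^sup>2 * (avg_power h p m + \<sigma>\<^sup>2)) = ?X + \<sigma>\<^sup>2"
      by (simp add: distrib_left sum.distrib flip: sum_distrib_right)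
    then have "gamma_UL b \<sigma> h v p k n
        = of_real (p $ (k, n) * a k n / (?I + \<sigma>\<^sup>2 + (1 / (zeta b)\<^sup>2 - 1) * (?X + \<sigma>\<^sup>2)))"
      using gamma_UL_eq [of p \<sigma> b t k n h v, OF p_nonneg assms(2) \<zeta> assms(4) v] by (simp add: a_def)
    \<comment> \<open>Thermal noise and its quantization share add up to exactly \<open>c\<close>,
      the constant of the downlink balance.\<close>
    also have "?I + \<sigma>\<^sup>2 + (1 / (zeta b)\<^sup>2 - 1) * (?X + \<sigma>\<^sup>2) = ?I + (1 / (zeta b)\<^sup>2 - 1) * ?X + c"
      by (simp add: c_def algebra_simps)
    also have "\<dots> = d (k, n) * p $ (k, n)"
      unfolding ul_balance E_def coupling_column_sum ..
    also have "p $ (k, n) * a k n / (d (k, n) * p $ (k, n)) = \<gamma> k n"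
    proof -
      \<comment> \<open>Strict positivity is needed here: the power cancels from the ratio only if
        it is nonzero.\<close>
      have "d (k, n) * p $ (k, n) > 0"
        unfolding ul_balance using c
        by (intro add_nonneg_pos sum_nonneg mult_nonneg_nonneg E_nonneg p_nonneg)
      then have "p $ (k, n) \<noteq> 0" by auto
      with a [of k n] assms(3) [of k n] show ?thesis by (simp add: d_def)
    qed
    finally show ?thesis .
  qed
  show ?thesis
    using inv p_nonneg ul norms by blast
qed

end
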